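(* Let $G=\mathbb{Z}_{n_1}\times\cdots\times\mathbb{Z}_{n_d}$, where $n_1,\ldots,n_d\ge 2$, let $n=n_1\cdots n_d$, and let $S$ be an inverse-closed subset of $G\setminus\{(0,\ldots,0)\}$ with $\langle S\rangle=G$. Suppose that $|S|=p^l$ is a prime power ($p$ prime) such that $p^l\mid n$ but $p^{l+1}\nmid n$. Suppose further that exactly one of $n_1,\ldots,n_d$, say $n_t$, is divisible by $p$. Then $\mathrm{Cay}(G,S)$ admits a total perfect code if and only if $s_t\not\equiv s'_t\pmod{p^l}$ for each pair of distinct elements $(s_1,\ldots,s_d),(s'_1,\ldots,s'_d)$ of $S$.
   Context: Inverse-closed means $-S=S$. The Cayley graph $\mathrm{Cay}(G,S)$ has vertex set $G$, with $x,y$ adjacent iff $y-x\in S$. A total perfect code in a graph is a set $C$ of vertices such that every vertex of the graph (including those in $C$) is adjacent to exactly one vertex of $C$. Congruence of elements of $\mathbb{Z}_{n_t}$ modulo $p^l$ makes sense since $p^l\mid n_t$. *)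

theory Defs
  imports
    "HOL-Algebra.Product_Groups"
    "HOL-Algebra.Elementary_Groups"
    "HOL-Algebra.Generated_Groups"
    "HOL-Computational_Algebra.Primes"
    "HOL-Number_Theory.Cong"
    "Graph_Theory.Pair_Digraph"
begin

text \<open>
  HOL-Algebra writes groups multiplicatively, so the sum and difference of the
  (additively written) abelian groups below are \<open>x \<otimes> y\<close> and \<open>y \<otimes> inv x\<close>.
\<close>

definition cyclic_product :: "nat \<Rightarrow> (nat \<Rightarrow> nat) \<Rightarrow> (nat \<Rightarrow> int) monoid" where
  "cyclic_product d n = product_group {1..d} (\<lambda>i. integer_mod_group (n i))"

definition inverse_closed :: "('a, 'b) monoid_scheme \<Rightarrow> 'a set \<Rightarrow> bool" where
  "inverse_closed G S \<longleftrightarrow> m_inv G ` S = S"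

text \<open>
  An undirected graph is represented by the digraph having both orientations of every edge.
  For an inverse-closed connection set \<open>S\<close> not containing the identity, the Cayley graph
  is a simple graph in this sense; see \<open>cayley_graph_pair_graph\<close> below.
\<close>

definition cayley_graph :: "('a, 'b) monoid_scheme \<Rightarrow> 'a set \<Rightarrow> 'a pair_pre_digraph" where
  "cayley_graph G S =
     \<lparr>pverts = carrier G,
      parcs = {(x, y). x \<in> carrier G \<and> y \<in> carrier G \<and> y \<otimes>\<^bsub>G\<^esub> inv\<^bsub>G\<^esub> x \<in> S}\<rparr>"

definition total_perfect_code :: "'a pair_pre_digraph \<Rightarrow> 'a set \<Rightarrow> bool" where
  "total_perfect_code \<Gamma> C \<longleftrightarrow>
     C \<subseteq> pverts \<Gamma> \<and> (\<forall>v \<in> pverts \<Gamma>. \<exists>!c. c \<in> C \<and> (v, c) \<in> parcs \<Gamma>)"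

lemma cayley_graph_pair_graph:
  assumes "group G" and fin: "finite (carrier G)"
    and S: "S \<subseteq> carrier G - {\<one>\<^bsub>G\<^esub>}" and inv: "inverse_closed G S"
  shows "pair_graph (cayley_graph G S)"
proof -
  interpret group G by fact
  have sym: "x \<otimes>\<^bsub>G\<^esub> inv\<^bsub>G\<^esub> y \<in> S"
    if "x \<in> carrier G" "y \<in> carrier G" "y \<otimes>\<^bsub>G\<^esub> inv\<^bsub>G\<^esub> x \<in> S" for x y
  proof -
    have "inv\<^bsub>G\<^esub> (y \<otimes>\<^bsub>G\<^esub> inv\<^bsub>G\<^esub> x) \<in> S"
      using that inv unfolding inverse_closed_def by blast
    then show ?thesis
      using that by (simp add: inv_mult_group)
  qed
  have "finite (parcs (cayley_graph G S))"
    by (rule finite_subset[of _ "carrier G \<times> carrier G"])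
       (use fin in \<open>auto simp: cayley_graph_def\<close>)
  then show ?thesis
    using fin S sym
    by unfold_locales (auto simp: cayley_graph_def symmetric_def sym_def r_inv)
qed

end

theory Submission
  imports Defs
begin

text \<open>
  Written additively, a total perfect code \<open>C\<close> of \<open>Cay(G, S)\<close> is a tiling of the finite abelian
  group \<open>G\<close>: every \<open>v\<close> is \<open>-s + c\<close> for exactly one pair \<open>(s, c) \<in> S \<times> C\<close>
  (\<open>total_perfect_code_imp_tiling\<close>).

  If the coordinates \<open>s\<^sub>t\<close> are pairwise incongruent modulo \<open>p^l = |S|\<close>, they represent every
  residue class exactly once, so the subgroup of all \<open>x\<close> with \<open>p^l\<close> dividing \<open>x\<^sub>t\<close> is a total
  perfect code: from each \<open>v\<close> exactly one step in \<open>S\<close> leads into it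
  (\<open>total_perfect_code_if_incongruent\<close>).

  The converse rests on the replacement principle for tilings (\<open>tiling_coprime_pow\<close>): if
  \<open>A + B = G\<close> is a tiling and \<open>k\<close> is coprime to \<open>|A|\<close>, then the multiples \<open>k a\<close> also tile \<open>G\<close>
  with \<open>B\<close>, so in particular they are pairwise distinct. It suffices to treat a prime \<open>k = q\<close>.
  In the tuples \<open>(a\<^sub>1, \<dots>, a\<^sub>q, b)\<close> with sum \<open>g\<close>, all but one of the \<open>a\<^sub>i\<close> can be chosen freely and
  the rest is then determined, so there are \<open>|A|^(q-1)\<close> of them, a number not divisible by \<open>q\<close>.
  Cyclic rotation of the \<open>a\<^sub>i\<close> therefore fixes at least one tuple, and a fixed tuple is a
  representation \<open>g = q a + b\<close>. Hence \<open>(a, b) \<mapsto> q a + b\<close> maps \<open>A \<times> B\<close> onto \<open>G\<close>, and since both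
  sides have the same size it is bijective.

  Apply this to \<open>A = -S\<close> and \<open>k = m = n / p^l\<close>, which is prime to \<open>p\<close>: multiplication by \<open>m\<close> is
  injective on \<open>S\<close>. As \<open>p\<close> divides only \<open>n\<^sub>t\<close>, every other \<open>n\<^sub>i\<close> divides \<open>m\<close>, and \<open>m\<close> is also a
  multiple of \<open>n\<^sub>t / p^l\<close>. So \<open>m s\<close> vanishes outside the coordinate \<open>t\<close> and depends there only on
  the class of \<open>s\<^sub>t\<close> modulo \<open>p^l\<close> (\<open>pow_eq_if_coordinate_cong\<close>). Distinct elements of \<open>S\<close> must
  therefore differ in that class.
\<close>

section \<open>Maps of prime period\<close>

text \<open>
  The map generates an action of the cyclic group of order \<open>q\<close>. Its orbits have size \<open>1\<close> or \<open>q\<close>,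
  and size \<open>1\<close> means a fixed point.
\<close>

lemma prime_dvd_card_if_no_fixpoint:
  fixes q :: nat and f :: "'a \<Rightarrow> 'a"
  assumes q: "prime q" and fin: "finite X"
    and closed: "\<And>x. x \<in> X \<Longrightarrow> f x \<in> X"
    and period: "\<And>x. x \<in> X \<Longrightarrow> (f ^^ q) x = x"
    and nofix: "\<And>x. x \<in> X \<Longrightarrow> f x \<noteq> x"
  shows "q dvd card X"
proof -
  have q0: "q > 0" using q by (rule prime_gt_0_nat)
  have closed': "(f ^^ i) x \<in> X" if "x \<in> X" for x i
    using that closed by (induction i) auto
  have reduce: "(f ^^ (i mod q)) x = (f ^^ i) x" if "x \<in> X" for x i
    using that by (intro funpow_mod_eq period)
  have undo: "(f ^^ (q - i mod q)) ((f ^^ i) x) = x" if x: "x \<in> X" for x i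
  proof -
    have "(f ^^ (q - i mod q)) ((f ^^ (i mod q)) x) = (f ^^ (q - i mod q + i mod q)) x"
      by (simp only: funpow_add o_apply)
    also have "q - i mod q + i mod q = q"
      using q0 by (simp add: less_imp_le)
    finally show ?thesis using x by (simp add: period reduce)
  qed
  have no_coincidence: False if x: "x \<in> X" and ij: "i < j" "j < q"
    and eq: "(f ^^ i) x = (f ^^ j) x" for x i j
  proof -
    have "(f ^^ (j - i)) ((f ^^ i) x) = (f ^^ (j - i + i)) x"
      by (simp only: funpow_add o_apply)
    also have "\<dots> = (f ^^ i) x"
      using ij eq by simp
    finally have per: "(f ^^ (j - i)) ((f ^^ i) x) = (f ^^ i) x" .
    define y where "y = (f ^^ i) x"
    have y: "y \<in> X" using x closed' y_def by blast
    \<comment> \<open>Both \<open>j - i\<close> and \<open>q\<close> are periods of \<open>y\<close>. They are coprime, so \<open>1\<close> is a period too and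
       \<open>y\<close> is a forbidden fixed point.\<close>
    have "\<not> q dvd (j - i)" using ij by (auto dest: dvd_imp_le)
    then have "coprime (j - i) q"
      using q prime_imp_coprime[of q "j - i"] by (simp add: coprime_commute)
    then obtain u where u: "[(j - i) * u = 1] (mod q)"
      using cong_solve_coprime_nat by auto
    have "(f ^^ ((j - i) * u)) y = y"
      using funpow_mod_eq[OF per, of "(j - i) * u"] by (simp add: y_def)
    moreover have "(f ^^ ((j - i) * u)) y = (f ^^ 1) y"
      using reduce[OF y] u unfolding cong_def by metis
    ultimately show False using nofix[OF y] by simp
  qed
  \<comment> \<open>The orbits are the classes of \<open>R\<close>; periodicity makes the forward reachability it records
     symmetric.\<close>
  define R where "R = {(x, y). x \<in> X \<and> (\<exists>i. y = (f ^^ i) x)}"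
  have equiv: "equiv X R"
  proof (rule equivI)
    show "R \<subseteq> X \<times> X"
      using closed' by (auto simp: R_def)
    show "refl_on X R"
      by (auto simp: refl_on_def R_def closed' intro: exI[of _ 0])
    show "sym R"
    proof (rule symI)
      fix x y assume "(x, y) \<in> R"
      then obtain i where xy: "x \<in> X" "y = (f ^^ i) x" by (auto simp: R_def)
      then have "x = (f ^^ (q - i mod q)) y" using undo by simp
      then show "(y, x) \<in> R" using xy closed' by (auto simp: R_def)
    qed
    show "trans R"
    proof (rule transI)
      fix x y z assume "(x, y) \<in> R" "(y, z) \<in> R"
      then obtain i j where "x \<in> X" "y = (f ^^ i) x" "z = (f ^^ j) y" by (auto simp: R_def)
      then have "x \<in> X" "z = (f ^^ (j + i)) x" by (simp_all add: funpow_add)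
      then show "(x, z) \<in> R" by (auto simp: R_def)
    qed
  qed
  have "card (R `` {x}) = q" if x: "x \<in> X" for x
  proof -
    have "R `` {x} = (\<lambda>i. (f ^^ i) x) ` {..<q}"
    proof (intro equalityI subsetI)
      fix y assume "y \<in> R `` {x}"
      then obtain i where "y = (f ^^ (i mod q)) x" using x reduce by (auto simp: R_def)
      then show "y \<in> (\<lambda>i. (f ^^ i) x) ` {..<q}" using q0 by auto
    qed (use x in \<open>auto simp: R_def\<close>)
    moreover have "inj_on (\<lambda>i. (f ^^ i) x) {..<q}"
    proof (rule inj_onI, rule ccontr)
      fix i j assume *: "i \<in> {..<q}" "j \<in> {..<q}" "(f ^^ i) x = (f ^^ j) x" "i \<noteq> j"
      then have "i < j \<or> j < i" by auto
      with * no_coincidence[OF x] show False by (metis lessThan_iff)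
    qed
    ultimately show ?thesis by (simp add: card_image)
  qed
  then have "\<forall>Y \<in> X // R. q dvd card Y"
    by (auto elim!: quotientE)
  then show ?thesis
    using equiv_imp_dvd_card[OF fin equiv] by blast
qed

section \<open>Tilings of abelian groups\<close>

context comm_group
begin

text \<open>
  A tuple \<open>(a\<^sub>1, \<dots>, a\<^sub>k, b)\<close> is stored as a list and a last entry. Starting the fold at \<open>b\<close> itself,
  rather than at \<open>\<one>\<close>, gives the product of the whole tuple. The tiling sets are indexed families
  \<open>h\<close>, so that replacing each element by a power changes \<open>h\<close> but leaves the index set and its
  cardinality alone, even before the powers are known to be distinct.
\<close>

lemma foldr_mult_eq_translation:
  assumes "\<And>a. a \<in> set xs \<Longrightarrow> h a \<in> carrier G"
  obtains P where "P \<in> carrier G"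
    and "\<And>z. z \<in> carrier G \<Longrightarrow> foldr (\<lambda>a. (\<otimes>) (h a)) xs z = P \<otimes> z"
proof -
  have "\<exists>P \<in> carrier G. \<forall>z \<in> carrier G. foldr (\<lambda>a. (\<otimes>) (h a)) xs z = P \<otimes> z"
    using assms
  proof (induction xs)
    case Nil
    show ?case by (intro bexI[of _ \<one>]) auto
  next
    case (Cons x xs)
    then obtain P where "P \<in> carrier G"
      "\<forall>z \<in> carrier G. foldr (\<lambda>a. (\<otimes>) (h a)) xs z = P \<otimes> z" by auto
    then show ?case
      using Cons.prems by (intro bexI[of _ "h x \<otimes> P"]) (auto simp: m_assoc)
  qed
  then show ?thesis using that by blast
qed

lemma foldr_mult_rotate1:
  assumes h: "\<And>a. a \<in> set xs \<Longrightarrow> h a \<in> carrier G" and z: "z \<in> carrier G"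
  shows "foldr (\<lambda>a. (\<otimes>) (h a)) (rotate1 xs) z = foldr (\<lambda>a. (\<otimes>) (h a)) xs z"
proof (cases xs)
  case (Cons y ys)
  obtain P where P: "P \<in> carrier G"
    "\<And>z. z \<in> carrier G \<Longrightarrow> foldr (\<lambda>a. (\<otimes>) (h a)) ys z = P \<otimes> z"
    by (rule foldr_mult_eq_translation[of ys h]) (use h Cons in auto)
  have "h y \<in> carrier G" using h Cons by simp
  then show ?thesis using P z Cons by (simp add: m_lcomm)
qed simp

lemma foldr_mult_replicate:
  assumes "h a \<in> carrier G" "z \<in> carrier G"
  shows "foldr (\<lambda>a. (\<otimes>) (h a)) (replicate k a) z = h a [^] k \<otimes> z"
proof (induction k)
  case (Suc k)
  then show ?case using assms by (simp add: nat_pow_Suc2 m_assoc m_lcomm)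
qed (use assms in simp)

text \<open>
  The last \<open>r\<close> letters of the word are arbitrary: once they are chosen, what remains is to write
  one fixed group element in the form \<open>h a \<otimes> b\<close>, and the tiling does this in exactly one way.
\<close>

lemma card_factorization_words:
  assumes fin: "finite A" and h: "\<And>a. a \<in> A \<Longrightarrow> h a \<in> carrier G" and B: "B \<subseteq> carrier G"
    and tiling: "bij_betw (\<lambda>(a, b). h a \<otimes> b) (A \<times> B) (carrier G)"
    and g: "g \<in> carrier G"
  shows "card {(xs, b). set xs \<subseteq> A \<and> length xs = Suc r \<and> b \<in> B \<and>
            foldr (\<lambda>a. (\<otimes>) (h a)) xs b = g} = card A ^ r"
    (is "card ?X = _")
proof -
  have translation: "\<exists>P \<in> carrier G. \<forall>a b. a \<in> A \<longrightarrow> b \<in> B \<longrightarrow>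
      (foldr (\<lambda>a. (\<otimes>) (h a)) (a # ys) b = g \<longleftrightarrow> h a \<otimes> b = inv P \<otimes> g)"
    if ys: "set ys \<subseteq> A" for ys
  proof -
    obtain P where P: "P \<in> carrier G"
      "\<And>z. z \<in> carrier G \<Longrightarrow> foldr (\<lambda>a. (\<otimes>) (h a)) ys z = P \<otimes> z"
      by (rule foldr_mult_eq_translation[of ys h]) (use h ys in auto)
    have "foldr (\<lambda>a. (\<otimes>) (h a)) (a # ys) b = P \<otimes> (h a \<otimes> b)" if "a \<in> A" "b \<in> B" for a b
      using P h B that by (auto simp: m_lcomm)
    then have "foldr (\<lambda>a. (\<otimes>) (h a)) (a # ys) b = g \<longleftrightarrow> h a \<otimes> b = inv P \<otimes> g"
      if "a \<in> A" "b \<in> B" for a b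
      using P(1) g h[OF that(1)] subsetD[OF B that(2)] that
      by (metis inv_solve_left m_closed)
    then show ?thesis using P(1) by blast
  qed
  have ex: "\<exists>a \<in> A. \<exists>b \<in> B. h a \<otimes> b = z" if "z \<in> carrier G" for z
    using tiling that by (force simp: bij_betw_def image_iff)
  have uniq: "a = a' \<and> b = b'"
    if "a \<in> A" "b \<in> B" "a' \<in> A" "b' \<in> B" "h a \<otimes> b = h a' \<otimes> b'" for a b a' b'
    using bij_betw_imp_inj_on[OF tiling] that unfolding inj_on_def by fastforce
  have "bij_betw (\<lambda>(xs, b). tl xs) ?X {ys. set ys \<subseteq> A \<and> length ys = r}"
    unfolding bij_betw_def
  proof (intro conjI equalityI subsetI)
    show "inj_on (\<lambda>(xs, b). tl xs) ?X"
    proof (rule inj_onI, clarify)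
      fix xs b xs' b'
      assume 1: "set xs \<subseteq> A" "length xs = Suc r" "b \<in> B"
        "g = foldr (\<lambda>a. (\<otimes>) (h a)) xs b"
        and 2: "set xs' \<subseteq> A" "length xs' = Suc r" "b' \<in> B"
        "foldr (\<lambda>a. (\<otimes>) (h a)) xs' b' = foldr (\<lambda>a. (\<otimes>) (h a)) xs b"
        and tl: "tl xs = tl xs'"
      obtain a ys where xs: "xs = a # ys" using 1(2) by (cases xs) auto
      obtain a' where xs': "xs' = a' # ys" using 2(2) tl xs by (cases xs') auto
      have "set ys \<subseteq> A" using 1(1) xs by auto
      from translation[OF this] have "h a \<otimes> b = h a' \<otimes> b'"
        using 1 2 xs xs' by (metis insert_subset list.simps(15))
      moreover have "a \<in> A" "a' \<in> A" using 1(1) 2(1) xs xs' by auto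
      ultimately have "a = a' \<and> b = b'" using uniq 1(3) 2(3) by blast
      then show "xs = xs' \<and> b = b'" using xs xs' by simp
    qed
  next
    fix ys assume "ys \<in> (\<lambda>(xs, b). tl xs) ` ?X"
    then show "ys \<in> {ys. set ys \<subseteq> A \<and> length ys = r}"
      by (auto simp: length_Suc_conv)
  next
    fix ys assume "ys \<in> {ys. set ys \<subseteq> A \<and> length ys = r}"
    then have ys: "set ys \<subseteq> A" "length ys = r" by auto
    obtain P where P: "P \<in> carrier G" "\<And>a b. a \<in> A \<Longrightarrow> b \<in> B \<Longrightarrow>
      (foldr (\<lambda>a. (\<otimes>) (h a)) (a # ys) b = g \<longleftrightarrow> h a \<otimes> b = inv P \<otimes> g)"
      using translation[OF ys(1)] by blast
    obtain a b where ab: "a \<in> A" "b \<in> B" "h a \<otimes> b = inv P \<otimes> g"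
      using ex[of "inv P \<otimes> g"] P(1) g by auto
    have "(a # ys, b) \<in> ?X" using ab P(2)[OF ab(1,2)] ys by simp
    then show "ys \<in> (\<lambda>(xs, b). tl xs) ` ?X" by (rule rev_image_eqI) simp
  qed
  then show ?thesis
    using card_lists_length_eq[OF fin, of r] by (simp add: bij_betw_same_card)
qed

text \<open>
  The \<open>q\<close>-th powers still cover \<open>G\<close> because the words representing \<open>g\<close> cannot all lie in rotation
  orbits of size \<open>q\<close>: their number is a power of \<open>card A\<close>.
\<close>

lemma tiling_prime_pow:
  assumes finG: "finite (carrier G)" and fin: "finite A"
    and h: "\<And>a. a \<in> A \<Longrightarrow> h a \<in> carrier G" and B: "B \<subseteq> carrier G"
    and tiling: "bij_betw (\<lambda>(a, b). h a \<otimes> b) (A \<times> B) (carrier G)"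
    and q: "prime q" and ndvd: "\<not> q dvd card A"
  shows "bij_betw (\<lambda>(a, b). h a [^] q \<otimes> b) (A \<times> B) (carrier G)"
proof -
  let ?X = "\<lambda>g. {(xs, b). set xs \<subseteq> A \<and> length xs = q \<and> b \<in> B \<and>
              foldr (\<lambda>a. (\<otimes>) (h a)) xs b = g}"
  obtain r where r: "q = Suc r" using prime_gt_0_nat[OF q] by (cases q) auto
  have "\<exists>a \<in> A. \<exists>b \<in> B. h a [^] q \<otimes> b = g" if g: "g \<in> carrier G" for g
  proof (rule ccontr)
    assume none: "\<not> ?thesis"
    have "q dvd card (?X g)"
    proof (rule prime_dvd_card_if_no_fixpoint[OF q, where f = "apfst rotate1"])
      have "?X g \<subseteq> {xs. set xs \<subseteq> A \<and> length xs = q} \<times> B" by auto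
      then show "finite (?X g)"
        using finite_lists_length_eq[OF fin] finite_subset[OF B finG]
        by (meson finite_SigmaI finite_subset)
    next
      fix x assume x: "x \<in> ?X g"
      then obtain xs b where xb: "x = (xs, b)" "set xs \<subseteq> A" "length xs = q" "b \<in> B"
        "foldr (\<lambda>a. (\<otimes>) (h a)) xs b = g" by auto
      show "apfst rotate1 x \<in> ?X g"
        using xb foldr_mult_rotate1[of xs h b] h B by auto
      have "(apfst rotate1 ^^ k) (xs, b) = (rotate k xs, b)" for k
        by (induction k) auto
      then show "(apfst rotate1 ^^ q) x = x" using xb by simp
      show "apfst rotate1 x \<noteq> x"
      proof
        assume "apfst rotate1 x = x"
        then have "rotate1 xs = xs" using xb by simp
        \<comment> \<open>A word fixed by rotation is constant, and its product is a representation of \<open>g\<close> of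
           the excluded kind.\<close>
        then have "card (set xs) = 1" using rotate1_fixpoint_card xb(3) r by fastforce
        then obtain a where a: "set xs = {a}" by (auto simp: card_1_singleton_iff)
        then have "xs = replicate q a"
          using xb(3) by (metis replicate_length_same singletonD)
        then have "h a [^] q \<otimes> b = g"
          using xb h B a foldr_mult_replicate[of h a b q] by auto
        then show False using none a xb by auto
      qed
    qed
    then have "q dvd card A ^ r"
      using card_factorization_words[OF fin h B tiling g, of r] r by simp
    then show False using q ndvd prime_dvd_power by blast
  qed
  moreover have "h a [^] q \<otimes> b \<in> carrier G" if "a \<in> A" "b \<in> B" for a b
    using h B that by auto
  ultimately have surj: "(\<lambda>(a, b). h a [^] q \<otimes> b) ` (A \<times> B) = carrier G"
    by (force simp: image_iff)
  have "finite (A \<times> B)" using fin finite_subset[OF B finG] by simp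
  then have "inj_on (\<lambda>(a, b). h a [^] q \<otimes> b) (A \<times> B)"
    using surj bij_betw_same_card[OF tiling] by (simp add: eq_card_imp_inj_on)
  with surj show ?thesis by (simp add: bij_betw_def)
qed

text \<open>
  This is the replacement principle for factorizations of finite abelian groups. It follows by
  applying the prime case to one prime factor of \<open>k\<close> after the other.
\<close>

lemma tiling_coprime_pow:
  assumes finG: "finite (carrier G)" and fin: "finite A"
    and h: "\<And>a. a \<in> A \<Longrightarrow> h a \<in> carrier G" and B: "B \<subseteq> carrier G"
    and tiling: "bij_betw (\<lambda>(a, b). h a \<otimes> b) (A \<times> B) (carrier G)"
    and k: "k > 0" and cop: "coprime k (card A)"
  shows "bij_betw (\<lambda>(a, b). h a [^] k \<otimes> b) (A \<times> B) (carrier G)"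
  using k cop
proof (induction k rule: prime_divisors_induct)
  case (unit k)
  have "bij_betw (\<lambda>(a, b). h a [^] (1::nat) \<otimes> b) (A \<times> B) (carrier G) \<longleftrightarrow>
    bij_betw (\<lambda>(a, b). h a \<otimes> b) (A \<times> B) (carrier G)"
    by (rule bij_betw_cong) (use h in auto)
  with unit tiling show ?case by simp
next
  case (factor q k)
  have "\<not> q dvd card A"
    using factor.prems(2) factor.hyps
    by (metis coprime_common_divisor dvd_triv_left not_prime_unit)
  moreover have "bij_betw (\<lambda>(a, b). h a [^] k \<otimes> b) (A \<times> B) (carrier G)"
    using factor by simp
  ultimately have "bij_betw (\<lambda>(a, b). (h a [^] k) [^] q \<otimes> b) (A \<times> B) (carrier G)"
    using tiling_prime_pow[OF finG fin, of "\<lambda>a. h a [^] k" B q] h B factor.hyps by simp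
  moreover have "bij_betw (\<lambda>(a, b). (h a [^] k) [^] q \<otimes> b) (A \<times> B) (carrier G) \<longleftrightarrow>
    bij_betw (\<lambda>(a, b). h a [^] (q * k) \<otimes> b) (A \<times> B) (carrier G)"
    by (rule bij_betw_cong) (use h in \<open>auto simp: nat_pow_pow mult.commute\<close>)
  ultimately show ?case by simp
qed auto

section \<open>Total perfect codes in Cayley graphs\<close>

text \<open>
  The code element \<open>c\<close> adjacent to \<open>v\<close> satisfies \<open>c \<otimes> inv v = s \<in> S\<close>, that is
  \<open>v = inv s \<otimes> c\<close>, and its uniqueness is the uniqueness of this factorization.
\<close>

lemma total_perfect_code_imp_tiling:
  assumes S: "S \<subseteq> carrier G" and C: "total_perfect_code (cayley_graph G S) C"
  shows "C \<subseteq> carrier G" and "bij_betw (\<lambda>(s, c). inv s \<otimes> c) (S \<times> C) (carrier G)"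
proof -
  show C': "C \<subseteq> carrier G" using C by (simp add: total_perfect_code_def cayley_graph_def)
  have ex1: "\<exists>!c. c \<in> C \<and> c \<otimes> inv v \<in> S" if v: "v \<in> carrier G" for v
  proof -
    have "\<exists>!c. c \<in> C \<and> v \<in> carrier G \<and> c \<in> carrier G \<and> c \<otimes> inv v \<in> S"
      using C v by (simp add: total_perfect_code_def cayley_graph_def)
    then show ?thesis using C' v by (metis subsetD)
  qed
  have recover: "c \<otimes> inv (inv s \<otimes> c) = s" if "s \<in> S" "c \<in> C" for s c
  proof -
    have sc: "s \<in> carrier G" "c \<in> carrier G" using that S C' by auto
    then have "c \<otimes> inv (inv s \<otimes> c) = s \<otimes> (c \<otimes> inv c)"
      by (simp add: inv_mult m_lcomm[of c s "inv c"])
    then show ?thesis using sc by simp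
  qed
  show "bij_betw (\<lambda>(s, c). inv s \<otimes> c) (S \<times> C) (carrier G)"
    unfolding bij_betw_def
  proof (intro conjI equalityI subsetI)
    show "inj_on (\<lambda>(s, c). inv s \<otimes> c) (S \<times> C)"
    proof (rule inj_onI, clarify)
      fix s c s' c'
      assume *: "s \<in> S" "c \<in> C" "s' \<in> S" "c' \<in> C" "inv s \<otimes> c = inv s' \<otimes> c'"
      then have "inv s \<otimes> c \<in> carrier G" using S C' by auto
      then have "c = c'" using ex1 recover * by metis
      then show "s = s' \<and> c = c'" using recover * by metis
    qed
  next
    fix v assume "v \<in> (\<lambda>(s, c). inv s \<otimes> c) ` (S \<times> C)"
    then show "v \<in> carrier G" using S C' by auto
  next
    fix v assume v: "v \<in> carrier G"
    then obtain c where c: "c \<in> C" "c \<otimes> inv v \<in> S" using ex1 by blast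
    then have cG: "c \<in> carrier G" using C' by auto
    then have "inv (c \<otimes> inv v) = v \<otimes> inv c"
      using v by (simp add: inv_mult_group)
    then have "inv (c \<otimes> inv v) \<otimes> c = v" using v cG by (simp add: m_assoc)
    then show "v \<in> (\<lambda>(s, c). inv s \<otimes> c) ` (S \<times> C)"
      using c by (intro image_eqI[of _ _ "(c \<otimes> inv v, c)"]) auto
  qed
qed

text \<open>
  Elements with the same \<open>k\<close>-th power would give two factorizations of one element in the tiling
  by \<open>k\<close>-th powers, as soon as the code is nonempty; it is, because \<open>\<one>\<close> has a neighbour in it.
\<close>

lemma pow_inj_on_connection_set:
  assumes finG: "finite (carrier G)" and S: "S \<subseteq> carrier G"
    and C: "total_perfect_code (cayley_graph G S) C"
    and k: "k > 0" and cop: "coprime k (card S)"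
  shows "inj_on (\<lambda>s. s [^] k) S"
proof (rule inj_onI)
  fix s s' assume s: "s \<in> S" "s' \<in> S" and eq: "s [^] k = s' [^] k"
  note tiling = total_perfect_code_imp_tiling[OF S C]
  have "bij_betw (\<lambda>(s, c). inv s [^] k \<otimes> c) (S \<times> C) (carrier G)"
    using tiling_coprime_pow[OF finG finite_subset[OF S finG], of "m_inv G" C k] tiling S k cop
    by auto
  then have inj: "inj_on (\<lambda>(s, c). inv s [^] k \<otimes> c) (S \<times> C)"
    by (rule bij_betw_imp_inj_on)
  obtain c where c: "c \<in> C"
    using tiling(2) one_closed by (fastforce simp: bij_betw_def)
  have "inv s [^] k = inv s' [^] k"
    using eq s S by (metis nat_pow_inv subsetD)
  with inj_onD[OF inj, of "(s, c)" "(s', c)"] s c show "s = s'" by simp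
qed

end

section \<open>Products of cyclic groups\<close>

lemma comm_group_cyclic_product: "comm_group (cyclic_product d n)"
proof (rule group.group_comm_groupI)
  show "group (cyclic_product d n)" by (simp add: cyclic_product_def)
qed (auto simp: cyclic_product_def add.commute)

lemma pow_cyclic_product:
  fixes k :: nat
  assumes "x \<in> carrier (cyclic_product d n)" "i \<in> {1..d}"
  shows "(x [^]\<^bsub>cyclic_product d n\<^esub> k) i = (int k * x i) mod int (n i)"
proof (induction k)
  case 0
  show ?case using assms(2) by (simp add: cyclic_product_def)
next
  case (Suc k)
  then show ?case using assms(2)
    by (simp add: cyclic_product_def add.commute mod_add_right_eq distrib_left mult.commute)
qed

lemma finite_cyclic_product:
  assumes "\<And>i. i \<in> {1..d} \<Longrightarrow> n i > 0"
  shows "finite (carrier (cyclic_product d n))"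
proof -
  have "finite (carrier (integer_mod_group (n i)))" if "i \<in> {1..d}" for i
    using assms[OF that] by (simp add: carrier_integer_mod_group)
  then show ?thesis
    unfolding cyclic_product_def carrier_product_group by (intro finite_PiE) auto
qed

lemma cong_coordinate_mult:
  assumes "i \<in> {1..d}" and "M dvd n i"
  shows "[(x \<otimes>\<^bsub>cyclic_product d n\<^esub> y) i = x i + y i] (mod int M)"
proof -
  have "int M dvd int (n i)" using assms(2) by simp
  then show ?thesis using assms(1) by (simp add: cyclic_product_def cong_def mod_mod_cancel)
qed

text \<open>
  The code is the kernel of reducing the coordinate \<open>t\<close> modulo \<open>M\<close>. By counting, \<open>S\<close> meets each
  residue class exactly once, so each \<open>v\<close> has exactly one \<open>s \<in> S\<close> with \<open>s t\<close> congruent to \<open>- v t\<close>.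
\<close>

lemma total_perfect_code_if_incongruent:
  assumes npos: "\<And>i. i \<in> {1..d} \<Longrightarrow> n i > 0"
    and S: "S \<subseteq> carrier (cyclic_product d n)"
    and t: "t \<in> {1..d}" and M: "M dvd n t" and cardS: "card S = M"
    and incong: "\<And>s s'. s \<in> S \<Longrightarrow> s' \<in> S \<Longrightarrow> [s t = s' t] (mod int M) \<Longrightarrow> s = s'"
  shows "total_perfect_code (cayley_graph (cyclic_product d n) S)
           {x \<in> carrier (cyclic_product d n). [x t = 0] (mod int M)}"
proof -
  let ?G = "cyclic_product d n"
  interpret comm_group ?G by (rule comm_group_cyclic_product)
  note coord = cong_coordinate_mult[of t d M n, OF t M]
  have M0: "M > 0" using M npos[OF t] by (auto intro: Nat.gr0I)
  have "inj_on (\<lambda>s. s t mod int M) S"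
    using incong by (auto simp: inj_on_def cong_def)
  moreover have "(\<lambda>s. s t mod int M) ` S \<subseteq> {0..<int M}" using M0 by auto
  ultimately have residues: "(\<lambda>s. s t mod int M) ` S = {0..<int M}"
    by (intro card_subset_eq) (auto simp: card_image cardS)
  have ex1: "\<exists>!c. (c \<in> carrier ?G \<and> [c t = 0] (mod int M)) \<and> c \<otimes>\<^bsub>?G\<^esub> inv\<^bsub>?G\<^esub> v \<in> S"
    if v: "v \<in> carrier ?G" for v
  proof (rule ex_ex1I)
    have "(- v t) mod int M \<in> (\<lambda>s. s t mod int M) ` S" using residues M0 by simp
    then obtain s where s: "s \<in> S" "[s t = - v t] (mod int M)" by (auto simp: cong_def)
    have "[(s \<otimes>\<^bsub>?G\<^esub> v) t = - v t + v t] (mod int M)"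
      using coord s(2) by (meson cong_add cong_refl cong_trans)
    moreover have "s \<in> carrier ?G" using s S by auto
    ultimately show "\<exists>c. (c \<in> carrier ?G \<and> [c t = 0] (mod int M)) \<and> c \<otimes>\<^bsub>?G\<^esub> inv\<^bsub>?G\<^esub> v \<in> S"
      using v s by (intro exI[of _ "s \<otimes>\<^bsub>?G\<^esub> v"]) (simp add: m_assoc)
  next
    fix c c'
    assume c: "(c \<in> carrier ?G \<and> [c t = 0] (mod int M)) \<and> c \<otimes>\<^bsub>?G\<^esub> inv\<^bsub>?G\<^esub> v \<in> S"
      and c': "(c' \<in> carrier ?G \<and> [c' t = 0] (mod int M)) \<and> c' \<otimes>\<^bsub>?G\<^esub> inv\<^bsub>?G\<^esub> v \<in> S"
    have "[c t + (inv\<^bsub>?G\<^esub> v) t = c' t + (inv\<^bsub>?G\<^esub> v) t] (mod int M)"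
      using c c' by (intro cong_add cong_refl) (meson cong_sym cong_trans)
    then have "[(c \<otimes>\<^bsub>?G\<^esub> inv\<^bsub>?G\<^esub> v) t = (c' \<otimes>\<^bsub>?G\<^esub> inv\<^bsub>?G\<^esub> v) t] (mod int M)"
      using coord by (meson cong_sym cong_trans)
    then have "c \<otimes>\<^bsub>?G\<^esub> inv\<^bsub>?G\<^esub> v = c' \<otimes>\<^bsub>?G\<^esub> inv\<^bsub>?G\<^esub> v" using incong c c' by blast
    then show "c = c'" using c c' v right_cancel[of "inv\<^bsub>?G\<^esub> v" c c'] by simp
  qed
  show ?thesis (is "total_perfect_code ?\<Gamma> ?C")
    unfolding total_perfect_code_def
  proof (intro conjI ballI)
    show "?C \<subseteq> pverts ?\<Gamma>" by (auto simp: cayley_graph_def)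
  next
    fix v assume "v \<in> pverts ?\<Gamma>"
    then have v: "v \<in> carrier ?G" by (simp add: cayley_graph_def)
    have "c \<in> ?C \<and> (v, c) \<in> parcs ?\<Gamma> \<longleftrightarrow>
      (c \<in> carrier ?G \<and> [c t = 0] (mod int M)) \<and> c \<otimes>\<^bsub>?G\<^esub> inv\<^bsub>?G\<^esub> v \<in> S" for c
      using v by (auto simp: cayley_graph_def)
    then show "\<exists>!c. c \<in> ?C \<and> (v, c) \<in> parcs ?\<Gamma>" using ex1[OF v] by presburger
  qed
qed

text \<open>
  With \<open>N\<close> the product of all \<open>n i\<close>, the exponent is \<open>N / M\<close>. It annihilates every coordinate other
  than \<open>t\<close>, and turns a multiple of \<open>M\<close> in the coordinate \<open>t\<close> into a multiple of \<open>n t\<close>.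
\<close>

lemma pow_eq_if_coordinate_cong:
  assumes x: "x \<in> carrier (cyclic_product d n)" and y: "y \<in> carrier (cyclic_product d n)"
    and t: "t \<in> {1..d}" and M: "M dvd n t" and cong: "[x t = y t] (mod int M)"
    and m: "m = n t div M * (\<Prod>i \<in> {1..d} - {t}. n i)"
  shows "x [^]\<^bsub>cyclic_product d n\<^esub> m = y [^]\<^bsub>cyclic_product d n\<^esub> m"
proof -
  let ?G = "cyclic_product d n"
  interpret comm_group ?G by (rule comm_group_cyclic_product)
  have "int (n i) dvd int m * x i - int m * y i" if i: "i \<in> {1..d}" for i
  proof (cases "i = t")
    case True
    have "int M dvd x t - y t" using cong by (simp add: cong_iff_dvd_diff)
    then have "int (n t div M) * int M dvd int m * (x t - y t)"
      using m by (intro mult_dvd_mono) simp_all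
    moreover have "int (n t div M) * int M = int (n t)"
      using M by (simp flip: of_nat_mult)
    ultimately show ?thesis using True by (simp add: right_diff_distrib)
  next
    case False
    then have "n i dvd (\<Prod>i \<in> {1..d} - {t}. n i)" using i by (intro dvd_prodI) auto
    then have "n i dvd m" using m by simp
    then have "int (n i) dvd int m" by simp
    then show ?thesis by simp
  qed
  then have coords: "(x [^]\<^bsub>?G\<^esub> m) i = (y [^]\<^bsub>?G\<^esub> m) i" if "i \<in> {1..d}" for i
    using that x y by (simp add: pow_cyclic_product mod_eq_dvd_iff)
  have "x [^]\<^bsub>?G\<^esub> m \<in> carrier ?G" "y [^]\<^bsub>?G\<^esub> m \<in> carrier ?G" using x y by simp_all
  then show ?thesis
    unfolding cyclic_product_def carrier_product_group
    by (rule PiE_ext) (use coords in \<open>simp add: cyclic_product_def\<close>)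
qed

theorem theorem4p8:
  fixes d :: nat and n :: "nat \<Rightarrow> nat" and S :: "(nat \<Rightarrow> int) set"
    and p l t :: nat
  defines "G \<equiv> cyclic_product d n"
  assumes "\<And>i. i \<in> {1..d} \<Longrightarrow> n i \<ge> 2"
    and "S \<subseteq> carrier G - {\<one>\<^bsub>G\<^esub>}"
    and "inverse_closed G S"
    and "generate G S = carrier G"
    and "prime p"
    and "card S = p ^ l"
    and "p ^ l dvd (\<Prod>i = 1..d. n i)"
    and "\<not> p ^ (l + 1) dvd (\<Prod>i = 1..d. n i)"
    and "t \<in> {1..d}"
    and "\<And>i. i \<in> {1..d} \<Longrightarrow> p dvd n i \<longleftrightarrow> i = t"
  shows "(\<exists>C. total_perfect_code (cayley_graph G S) C) \<longleftrightarrow>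
    (\<forall>s \<in> S. \<forall>s' \<in> S. s \<noteq> s' \<longrightarrow> \<not> [s t = s' t] (mod int (p ^ l)))"
proof -
  interpret comm_group G unfolding G_def by (rule comm_group_cyclic_product)
  have npos: "n i > 0" if "i \<in> {1..d}" for i using assms(2)[OF that] by simp
  have S: "S \<subseteq> carrier G" using assms(3) by auto
  define rest where "rest = (\<Prod>i \<in> {1..d} - {t}. n i)"
  define m where "m = n t div p ^ l * rest"
  have prod: "(\<Prod>i = 1..d. n i) = n t * rest"
    unfolding rest_def using assms(10) by (intro prod.remove) auto
  have "coprime p rest"
    unfolding rest_def
  proof (rule prod_coprime_right)
    fix i assume "i \<in> {1..d} - {t}"
    then have "\<not> p dvd n i" using assms(11) by simp
    then show "coprime p (n i)" using assms(6) by (rule prime_imp_coprime[rotated])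
  qed
  then have "coprime (p ^ l) rest" by simp
  then have dvd: "p ^ l dvd n t"
    using assms(8) unfolding prod by (simp add: coprime_dvd_mult_left_iff)
  have prod_m: "(\<Prod>i = 1..d. n i) = p ^ l * m"
    unfolding prod m_def using dvd by simp
  \<comment> \<open>Here the exactness of \<open>p ^ l\<close> enters: it leaves no factor \<open>p\<close> in the cofactor \<open>m\<close>.\<close>
  have "\<not> p dvd m"
  proof
    assume "p dvd m"
    then have "p ^ l * p dvd p ^ l * m" by (intro mult_dvd_mono) simp_all
    then show False using assms(9) unfolding prod_m by (simp add: mult.commute)
  qed
  then have cop: "coprime m (card S)" and m0: "m > 0"
    using prime_imp_coprime[OF assms(6), of m] unfolding assms(7)
    by (auto simp: coprime_commute[of m] intro!: Nat.gr0I)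
  have finG: "finite (carrier G)"
    unfolding G_def by (rule finite_cyclic_product) (rule npos)
  show ?thesis
  proof
    assume "\<exists>C. total_perfect_code (cayley_graph G S) C"
    then obtain C where C: "total_perfect_code (cayley_graph G S) C" ..
    have inj: "inj_on (\<lambda>s. s [^]\<^bsub>G\<^esub> m) S"
      by (rule pow_inj_on_connection_set[OF finG S C m0 cop])
    show "\<forall>s \<in> S. \<forall>s' \<in> S. s \<noteq> s' \<longrightarrow> \<not> [s t = s' t] (mod int (p ^ l))"
    proof (intro ballI impI notI)
      fix s s' assume s: "s \<in> S" "s' \<in> S" "s \<noteq> s'" and "[s t = s' t] (mod int (p ^ l))"
      then have "s [^]\<^bsub>G\<^esub> m = s' [^]\<^bsub>G\<^esub> m"
        using pow_eq_if_coordinate_cong[of s d n s' t "p ^ l" m] assms(10) dvd S m_def rest_def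
        unfolding G_def by blast
      then show False using inj_onD[OF inj] s by blast
    qed
  next
    assume "\<forall>s \<in> S. \<forall>s' \<in> S. s \<noteq> s' \<longrightarrow> \<not> [s t = s' t] (mod int (p ^ l))"
    then show "\<exists>C. total_perfect_code (cayley_graph G S) C"
      using total_perfect_code_if_incongruent[of d n S t "p ^ l"] npos assms(7,10) dvd S
      unfolding G_def by blast
  qed
qed

end
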